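(* Let $(X,\mu)$ be a measure space and let $f\in L^1_{loc}(X)$ be a real-valued function such that its distribution function $d_{f,\mu}$ is not identically infinite. Then the following conditions are equivalent: (i) $f^*(t)$ is finite for all $t>0$, and there exists $M\geq 0$, independent of $t$, such that $f^{**}(t)-f^*(t)\leq M$ for all $t>0$. (ii) There exist constants $\alpha\geq 0$ and $M\geq 0$ such that for all $\lambda>\alpha$ we have $d_{f,\mu}(\lambda)<\infty$ and $$\int_{\{x\in X:|f(x)|>\lambda\}}|f|\,d\mu\leq(\lambda+M)\,d_{f,\mu}(\lambda).$$ (iii) There exist constants $\alpha\geq 0$ and $M\geq 0$ such that for all $\lambda>\alpha$ we have $d_{f,\mu}(\lambda)<\infty$ and $$\int_\lambda^\infty d_{f,\mu}(s)\,ds\leq M\,d_{f,\mu}(\lambda).$$ (iv) There exist constants $c_1,c_2>0$ such that $$d_{f,\mu}(\lambda_2)\leq c_1\,d_{f,\mu}(\lambda_1)\,e^{c_2(\lambda_1-\lambda_2)}$$ for all $\lambda_2>\lambda_1\geq 0$.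
   Context: For a measurable $f:X\to\mathbb{R}$, the distribution function is $d_{f,\mu}:[0,\infty)\to[0,\infty]$, $d_{f,\mu}(\lambda)=\mu(\{x\in X:|f(x)|>\lambda\})$. The decreasing rearrangement of $f$ is $f^*:(0,\infty)\to[0,\infty]$, $f^*(t)=\inf\{\lambda\geq 0: d_{f,\mu}(\lambda)\leq t\}$, with $\inf\emptyset=\infty$. Moreover $f^{**}(t)=\frac1t\int_0^t f^*(s)\,ds$ for $t>0$. Here $f\in L^1_{loc}(X)$ means that $f$ is measurable and integrable over every measurable set of finite measure. *)

theory Defs
  imports "HOL-Analysis.Analysis"
begin

definition L1_loc :: "'a measure \<Rightarrow> ('a \<Rightarrow> real) \<Rightarrow> bool" where
  "L1_loc \<mu> f \<longleftrightarrow> f \<in> borel_measurable \<mu> \<and>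
     (\<forall>A\<in>sets \<mu>. emeasure \<mu> A < \<infinity> \<longrightarrow> set_integrable \<mu> A f)"

text \<open>The three functions below are total on the reals; only their values on the
  nonnegative (distribution function) resp. positive (rearrangement, its average)
  reals are meaningful.\<close>

definition distr_fun :: "'a measure \<Rightarrow> ('a \<Rightarrow> real) \<Rightarrow> real \<Rightarrow> ennreal" where
  "distr_fun \<mu> f r = emeasure \<mu> {x \<in> space \<mu>. \<bar>f x\<bar> > r}"

text \<open>The infimum is taken in \<^typ>\<open>ennreal\<close>, where the infimum of the empty set is
  infinity.\<close>

definition decr_rearr :: "'a measure \<Rightarrow> ('a \<Rightarrow> real) \<Rightarrow> real \<Rightarrow> ennreal" where
  "decr_rearr \<mu> f t = Inf (ennreal ` {r. 0 \<le> r \<and> distr_fun \<mu> f r \<le> ennreal t})"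

definition decr_rearr_avg :: "'a measure \<Rightarrow> ('a \<Rightarrow> real) \<Rightarrow> real \<Rightarrow> ennreal" where
  "decr_rearr_avg \<mu> f t =
     ennreal (1 / t) * (\<integral>\<^sup>+ s\<in>{0<..<t}. decr_rearr \<mu> f s \<partial>lborel)"

text \<open>Truncation of \<^typ>\<open>ennreal\<close> subtraction is harmless in
  \<open>decr_rearr_avg \<mu> f t - decr_rearr \<mu> f t\<close>: the rearrangement is nonincreasing, so the
  average dominates it, and infinity minus a finite value is infinity.\<close>

end

(* Write d for the distribution function. It is nonincreasing and right-continuous, so
   f*(t) <= r iff d(r) <= t, and the layer cake formula gives, with l = f*(t),
     t (f**(t) - f*(t)) = int_l^oo d     and     int_{|f| > r} |f| = r d(r) + int_r^oo d.
   Thus (i) and (ii) both amount to the tail bound (iii). Integrating (iv) gives (iii); conversely,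
   since h d(r + h) <= int_r^oo d, (iii) makes d at least halve over steps of length 2M + 1. *)
theory Submission
  imports Defs
begin

section \<open>Layer cake formula for functions with values in [0, oo]\<close>

text \<open>Superlevel sets of antitone functions are intervals. This gives measurability of d and
  of f* alike.\<close>

lemma borel_measurable_antimono_ennreal:
  fixes g :: "real \<Rightarrow> ennreal"
  assumes "antimono g"
  shows "g \<in> borel_measurable borel"
proof (rule borel_measurableI_greater)
  fix a
  have "is_interval {x. a < g x}"
    unfolding is_interval_1 using antimonoD[OF assms] by (force intro: less_le_trans)
  then show "{x \<in> space borel. a < g x} \<in> sets borel"
    by (simp add: real_interval_borel_measurable)
qed

text \<open>Presents a value in [0, oo] as the length of an interval, infinite values included, so
  that an integral of \<open>g\<close> becomes a double integral.\<close>

lemma emeasure_lborel_less_ennreal: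
  "emeasure lborel {r. 0 < r \<and> ennreal r < c} = c"
proof (cases c)
  case (real q)
  then have "{r. 0 < r \<and> ennreal r < c} = {0<..<q}"
    by (auto simp: ennreal_less_iff)
  with real show ?thesis by simp
next
  case top
  have "\<exists>q. 0 \<le> q \<and> emeasure lborel {0::real<..} = ennreal q" if "emeasure lborel {0::real<..} \<noteq> \<infinity>"
    using that by (cases "emeasure lborel {0::real<..}") auto
  moreover have False if q: "0 \<le> q" "emeasure lborel {0::real<..} = ennreal q" for q
  proof -
    have "emeasure lborel {0::real<..<q + 1} \<le> emeasure lborel {0::real<..}"
      by (rule emeasure_mono) auto
    with q show False by (simp add: ennreal_le_iff)
  qed
  ultimately have "emeasure lborel {0::real<..} = \<infinity>" by blast
  moreover have "{r. 0 < r \<and> ennreal r < c} = {0<..}"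
    using top by auto
  ultimately show ?thesis using top by simp
qed

text \<open>Each value \<open>g x\<close> is the length of the interval of levels below it; Tonelli
  then swaps points and levels, which is where sigma-finiteness enters.\<close>

lemma nn_integral_layer_cake:
  fixes g :: "'a \<Rightarrow> ennreal"
  assumes "sigma_finite_measure M" and [measurable]: "g \<in> borel_measurable M"
  shows "(\<integral>\<^sup>+ x. g x \<partial>M)
    = (\<integral>\<^sup>+ r\<in>{0<..}. emeasure M {x \<in> space M. ennreal r < g x} \<partial>lborel)"
proof -
  interpret sigma_finite_measure M by fact
  interpret pair_sigma_finite M lborel ..
  have "(\<integral>\<^sup>+ x. g x \<partial>M)
    = (\<integral>\<^sup>+ x. \<integral>\<^sup>+ r. indicator {r. 0 < r \<and> ennreal r < g x} r \<partial>lborel \<partial>M)"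
    by (simp add: emeasure_lborel_less_ennreal)
  also have "\<dots> = (\<integral>\<^sup>+ r. \<integral>\<^sup>+ x. indicator {r. 0 < r \<and> ennreal r < g x} r \<partial>M \<partial>lborel)"
    by (rule Fubini'[symmetric]) measurable
  also have "\<dots> = (\<integral>\<^sup>+ r\<in>{0<..}. emeasure M {x \<in> space M. ennreal r < g x} \<partial>lborel)"
  proof (rule nn_integral_cong)
    fix r :: real
    have "(\<integral>\<^sup>+ x. indicator {r. 0 < r \<and> ennreal r < g x} r \<partial>M)
      = (\<integral>\<^sup>+ x. indicator {0<..} r * indicator {x \<in> space M. ennreal r < g x} x \<partial>M)"
      by (rule nn_integral_cong) (auto simp: indicator_def)
    then show "(\<integral>\<^sup>+ x. indicator {r. 0 < r \<and> ennreal r < g x} r \<partial>M)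
      = emeasure M {x \<in> space M. ennreal r < g x} * indicator {0<..} r"
      by (simp add: nn_integral_cmult mult.commute)
  qed
  finally show ?thesis .
qed

text \<open>Passing to the restricted space asks for sigma-finiteness on \<open>A\<close> only, so
  \<open>M\<close> may be arbitrary once \<open>A\<close> has finite measure.\<close>

lemma set_nn_integral_layer_cake:
  fixes g :: "'a \<Rightarrow> ennreal"
  assumes [measurable]: "g \<in> borel_measurable M" "A \<in> sets M"
    and "sigma_finite_measure (restrict_space M A)"
  shows "(\<integral>\<^sup>+ x\<in>A. g x \<partial>M)
    = (\<integral>\<^sup>+ r\<in>{0<..}. emeasure M {x \<in> A. ennreal r < g x} \<partial>lborel)"
proof -
  have A: "A \<inter> space M = A"
    using sets.sets_into_space[OF assms(2)] by blast
  then have "{x \<in> space (restrict_space M A). P x} = {x \<in> A. P x}" for P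
    by (auto simp: space_restrict_space)
  then show ?thesis
    using nn_integral_layer_cake[OF assms(3), of g] A
    by (simp add: nn_integral_restrict_space emeasure_restrict_space
        measurable_restrict_space1)
qed

section \<open>The rearrangement as generalized inverse of the distribution function\<close>

lemma antimono_distr_fun:
  assumes [measurable]: "f \<in> borel_measurable \<mu>"
  shows "antimono (distr_fun \<mu> f)"
  unfolding distr_fun_def by (intro antimonoI emeasure_mono) auto

text \<open>The content is that the infimum defining f*, when finite, is attained. The bound on d is
  first obtained at every \<open>s > r\<close> and then carried to \<open>r\<close> by
  right-continuity of d, that is, by continuity from below of the measure along the sets
  \<open>?A n\<close>.\<close>

lemma decr_rearr_le_iff:
  assumes [measurable]: "f \<in> borel_measurable \<mu>" and "0 \<le> r"
  shows "decr_rearr \<mu> f t \<le> ennreal r \<longleftrightarrow> distr_fun \<mu> f r \<le> ennreal t"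
proof
  assume "distr_fun \<mu> f r \<le> ennreal t"
  with \<open>0 \<le> r\<close> show "decr_rearr \<mu> f t \<le> ennreal r"
    unfolding decr_rearr_def by (intro Inf_lower) auto
next
  assume le: "decr_rearr \<mu> f t \<le> ennreal r"
  have *: "distr_fun \<mu> f s \<le> ennreal t" if "r < s" for s
  proof -
    have "decr_rearr \<mu> f t < ennreal s"
      using le that \<open>0 \<le> r\<close> by (auto intro: le_less_trans ennreal_lessI)
    then obtain q where "0 \<le> q" "distr_fun \<mu> f q \<le> ennreal t" "q < s"
      unfolding decr_rearr_def Inf_less_iff by (auto simp: ennreal_less_iff)
    then show ?thesis
      using antimonoD[OF antimono_distr_fun[OF assms(1)], of q s] by auto
  qed
  let ?A = "\<lambda>n::nat. {x \<in> space \<mu>. r + 1 / Suc n < \<bar>f x\<bar>}"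
  have "{x \<in> space \<mu>. r < \<bar>f x\<bar>} = (\<Union>n. ?A n)"
  proof safe
    fix x assume "x \<in> space \<mu>" "r < \<bar>f x\<bar>"
    then obtain n where "1 / Suc n < \<bar>f x\<bar> - r"
      using nat_approx_posE[of "\<bar>f x\<bar> - r"] by auto
    then show "x \<in> (\<Union>n. ?A n)"
      using \<open>x \<in> space \<mu>\<close> by (auto intro!: exI[of _ n])
  next
    fix x n assume "r + 1 / real (Suc n) < \<bar>f x\<bar>"
    moreover have "0 < 1 / real (Suc n)" by simp
    ultimately show "r < \<bar>f x\<bar>" by linarith
  qed
  moreover have "incseq ?A"
  proof (rule incseq_SucI)
    fix n
    have "1 / real (Suc (Suc n)) \<le> 1 / real (Suc n)" by (simp add: field_simps)
    then show "?A n \<subseteq> ?A (Suc n)" by auto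
  qed
  ultimately have "distr_fun \<mu> f r = (SUP n. emeasure \<mu> (?A n))"
    unfolding distr_fun_def by (subst SUP_emeasure_incseq) auto
  also have "\<dots> \<le> ennreal t"
    using * by (intro SUP_least) (auto simp: distr_fun_def)
  finally show "distr_fun \<mu> f r \<le> ennreal t" .
qed

lemma antimono_decr_rearr: "antimono (decr_rearr \<mu> f)"
  unfolding decr_rearr_def
  by (intro antimonoI Inf_superset_mono image_mono) (auto intro: order_trans ennreal_leI)

context
  fixes \<mu> :: "'a measure" and f :: "'a \<Rightarrow> real"
  assumes f [measurable]: "f \<in> borel_measurable \<mu>"
begin

lemma distr_fun_measurable [measurable]: "distr_fun \<mu> f \<in> borel_measurable borel"
  by (intro borel_measurable_antimono_ennreal antimono_distr_fun f)

lemma distr_fun_mono: "r \<le> s \<Longrightarrow> distr_fun \<mu> f s \<le> distr_fun \<mu> f r"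
  using antimonoD[OF antimono_distr_fun[OF f]] .

section \<open>Tail integrals of the distribution function\<close>

text \<open>Layer cake for |f| on its superlevel set at \<open>l\<close>: levels below
  \<open>l\<close> cut out the whole set and contribute \<open>l\<close> times its measure, levels
  above \<open>l\<close> contribute the tail of d. Finiteness of d at \<open>l\<close> supplies
  sigma-finiteness.\<close>

lemma nn_integral_superlevel:
  assumes "0 \<le> l" and fin: "distr_fun \<mu> f l < \<infinity>"
  shows "(\<integral>\<^sup>+ x\<in>{x \<in> space \<mu>. \<bar>f x\<bar> > l}. ennreal \<bar>f x\<bar> \<partial>\<mu>)
    = ennreal l * distr_fun \<mu> f l + (\<integral>\<^sup>+ s\<in>{l<..}. distr_fun \<mu> f s \<partial>lborel)"
proof -
  let ?A = "{x \<in> space \<mu>. \<bar>f x\<bar> > l}"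
  have "finite_measure (restrict_space \<mu> ?A)"
    using fin by (intro finite_measureI)
      (auto simp: space_restrict_space emeasure_restrict_space distr_fun_def Int_absorb2)
  then have "(\<integral>\<^sup>+ x\<in>?A. ennreal \<bar>f x\<bar> \<partial>\<mu>)
    = (\<integral>\<^sup>+ r\<in>{0<..}. emeasure \<mu> {x \<in> ?A. ennreal r < ennreal \<bar>f x\<bar>} \<partial>lborel)"
    by (intro set_nn_integral_layer_cake) (auto simp: finite_measure_def)
  also have "\<dots> = (\<integral>\<^sup>+ r. distr_fun \<mu> f l * indicator {0<..<l} r
      + distr_fun \<mu> f r * indicator {l<..} r \<partial>lborel)"
  \<comment> \<open>The level \<open>l\<close> lies in neither interval on the right, so the
    integrands are compared off this null set only.\<close>
  proof (rule nn_integral_cong_AE, rule AE_mp[OF AE_lborel_singleton[of l]], intro AE_I2 impI)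
    fix r :: real assume "r \<noteq> l"
    moreover have "{x \<in> ?A. ennreal r < ennreal \<bar>f x\<bar>} = {x \<in> space \<mu>. \<bar>f x\<bar> > max r l}" if "0 < r"
      using that by (auto simp: ennreal_less_iff)
    ultimately show "emeasure \<mu> {x \<in> ?A. ennreal r < ennreal \<bar>f x\<bar>} * indicator {0<..} r
      = distr_fun \<mu> f l * indicator {0<..<l} r + distr_fun \<mu> f r * indicator {l<..} r"
      using \<open>0 \<le> l\<close> by (auto simp: distr_fun_def indicator_def max_def)
  qed
  also have "\<dots> = ennreal l * distr_fun \<mu> f l + (\<integral>\<^sup>+ s\<in>{l<..}. distr_fun \<mu> f s \<partial>lborel)"
    using \<open>0 \<le> l\<close> by (simp add: nn_integral_add nn_integral_cmult mult.commute)
  finally show ?thesis .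
qed

text \<open>Layer cake for f* on the interval from 0 to \<open>t\<close>. By
  \<open>decr_rearr_le_iff\<close>, f* exceeds the level \<open>r\<close> exactly at the points
  \<open>s\<close> below d(r), so the level set has length min(t, d(r)); this is \<open>t\<close>
  for \<open>r < l\<close> and d(r) for \<open>r > l\<close>.\<close>

lemma nn_integral_decr_rearr:
  assumes "0 < t" "0 \<le> l" and l: "decr_rearr \<mu> f t = ennreal l"
  shows "(\<integral>\<^sup>+ s\<in>{0<..<t}. decr_rearr \<mu> f s \<partial>lborel)
    = ennreal t * ennreal l + (\<integral>\<^sup>+ s\<in>{l<..}. distr_fun \<mu> f s \<partial>lborel)"
proof -
  have [measurable]: "decr_rearr \<mu> f \<in> borel_measurable borel"
    by (intro borel_measurable_antimono_ennreal antimono_decr_rearr)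
  have iff: "ennreal r < decr_rearr \<mu> f s \<longleftrightarrow> ennreal s < distr_fun \<mu> f r" if "0 \<le> r" for r s
    using decr_rearr_le_iff[OF f that, of s] by (simp add: not_le[symmetric])
  have "(\<integral>\<^sup>+ s\<in>{0<..<t}. decr_rearr \<mu> f s \<partial>lborel)
    = (\<integral>\<^sup>+ r\<in>{0<..}. emeasure lborel {s \<in> {0<..<t}. ennreal r < decr_rearr \<mu> f s} \<partial>lborel)"
    by (intro set_nn_integral_layer_cake sigma_finite_measure_restrict_space) (auto intro: sigma_finite_lborel)
  also have "\<dots> = (\<integral>\<^sup>+ r. ennreal t * indicator {0<..<l} r
      + distr_fun \<mu> f r * indicator {l<..} r \<partial>lborel)"
  proof (rule nn_integral_cong_AE, rule AE_mp[OF AE_lborel_singleton[of l]], intro AE_I2 impI)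
    fix r :: real assume "r \<noteq> l"
    show "emeasure lborel {s \<in> {0<..<t}. ennreal r < decr_rearr \<mu> f s} * indicator {0<..} r
      = ennreal t * indicator {0<..<l} r + distr_fun \<mu> f r * indicator {l<..} r"
    proof (cases "0 < r")
      case True
      let ?c = "min (ennreal t) (distr_fun \<mu> f r)"
      have "{s \<in> {0<..<t}. ennreal r < decr_rearr \<mu> f s} = {s. 0 < s \<and> ennreal s < ?c}"
        using True by (auto simp: iff ennreal_less_iff)
      then have "emeasure lborel {s \<in> {0<..<t}. ennreal r < decr_rearr \<mu> f s} = ?c"
        by (simp only: emeasure_lborel_less_ennreal)
      moreover have "l < r \<Longrightarrow> ?c = distr_fun \<mu> f r"
        using decr_rearr_le_iff[OF f, of r t] l True by (simp add: min_absorb2)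
      moreover have "r < l \<Longrightarrow> ?c = ennreal t"
        using iff[of r t] l True by (simp add: ennreal_less_iff min_absorb1)
      ultimately show ?thesis
        using True \<open>r \<noteq> l\<close> by (auto simp: indicator_def)
    qed (use \<open>0 \<le> l\<close> in \<open>auto simp: indicator_def\<close>)
  qed
  also have "\<dots> = ennreal t * ennreal l + (\<integral>\<^sup>+ s\<in>{l<..}. distr_fun \<mu> f s \<partial>lborel)"
    using \<open>0 \<le> l\<close> by (simp add: nn_integral_add nn_integral_cmult)
  finally show ?thesis .
qed

text \<open>After division by \<open>t\<close> the first term of
  \<open>nn_integral_decr_rearr\<close> is f*(t) itself. It may be cancelled in
  \<open>ennreal\<close> because \<open>l\<close> is finite.\<close>

lemma decr_rearr_avg_diff:
  assumes "0 < t" "0 \<le> l" and l: "decr_rearr \<mu> f t = ennreal l"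
  shows "decr_rearr_avg \<mu> f t - decr_rearr \<mu> f t
    = ennreal (1 / t) * (\<integral>\<^sup>+ s\<in>{l<..}. distr_fun \<mu> f s \<partial>lborel)"
proof -
  have "ennreal (1 / t) * (ennreal t * ennreal l) = ennreal l"
    using assms by (simp add: ennreal_mult[symmetric])
  then show ?thesis
    by (simp add: decr_rearr_avg_def nn_integral_decr_rearr[OF assms] distrib_left l)
qed

text \<open>Both sides of the first inequality contain the finite term r d(r), which cancels.
  Conditions (ii) and (iii) thus agree with the same constants.\<close>

lemma nn_integral_superlevel_le_iff:
  assumes "0 \<le> r" "0 \<le> M" and fin: "distr_fun \<mu> f r < \<infinity>"
  shows "(\<integral>\<^sup>+ x\<in>{x \<in> space \<mu>. \<bar>f x\<bar> > r}. ennreal \<bar>f x\<bar> \<partial>\<mu>)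
      \<le> ennreal (r + M) * distr_fun \<mu> f r
    \<longleftrightarrow> (\<integral>\<^sup>+ s\<in>{r<..}. distr_fun \<mu> f s \<partial>lborel) \<le> ennreal M * distr_fun \<mu> f r"
proof -
  have "ennreal r * distr_fun \<mu> f r \<noteq> \<infinity>"
    using fin by (simp add: ennreal_mult_eq_top_iff)
  then show ?thesis
    using assms(1,2)
    by (simp add: nn_integral_superlevel[OF assms(1) fin] ennreal_plus distrib_right
        ennreal_add_left_cancel_le)
qed

section \<open>Tail bound and exponential decay\<close>

lemma distr_fun_le_tail:
  "ennreal h * distr_fun \<mu> f (r + h) \<le> (\<integral>\<^sup>+ s\<in>{r<..}. distr_fun \<mu> f s \<partial>lborel)"
proof (cases "0 \<le> h")
  case True
  then have "ennreal h * distr_fun \<mu> f (r + h)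
    = (\<integral>\<^sup>+ s\<in>{r<..r + h}. distr_fun \<mu> f (r + h) \<partial>lborel)"
    by (simp add: nn_integral_cmult mult.commute)
  also have "\<dots> \<le> (\<integral>\<^sup>+ s\<in>{r<..}. distr_fun \<mu> f s \<partial>lborel)"
    by (intro nn_integral_mono) (auto simp: indicator_def distr_fun_mono)
  finally show ?thesis .
qed (simp add: ennreal_neg)

text \<open>The tail bound gives h d(r + h) <= M d(r) <= h d(r) / 2 for h = 2M + 1, so
  \<open>n\<close> steps of length \<open>h\<close> gain the factor 2^(-n) = exp(-n ln 2). This
  explains the rate ln 2 / h.\<close>

lemma distr_fun_exp_decay:
  assumes "0 \<le> \<alpha>" "0 \<le> M"
    and fin: "\<And>r. \<alpha> < r \<Longrightarrow> distr_fun \<mu> f r < \<infinity>"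
    and tail: "\<And>r. \<alpha> < r \<Longrightarrow>
      (\<integral>\<^sup>+ s\<in>{r<..}. distr_fun \<mu> f s \<partial>lborel) \<le> ennreal M * distr_fun \<mu> f r"
    and r: "\<alpha> < r\<^sub>1" "r\<^sub>1 \<le> r\<^sub>2"
  shows "distr_fun \<mu> f r\<^sub>2
    \<le> ennreal 2 * distr_fun \<mu> f r\<^sub>1 * ennreal (exp (ln 2 / (2 * M + 1) * (r\<^sub>1 - r\<^sub>2)))"
proof -
  \<comment> \<open>The summand 1 keeps \<open>h\<close> positive when \<open>M = 0\<close>.\<close>
  define h where "h = 2 * M + 1"
  define D where "D r = enn2real (distr_fun \<mu> f r)" for r
  have h: "0 < h" using \<open>0 \<le> M\<close> by (simp add: h_def)
  have D: "distr_fun \<mu> f r = ennreal (D r)" "0 \<le> D r" if "\<alpha> < r" for r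
    using fin[OF that] by (simp_all add: D_def)
  have half: "D (r + h) \<le> D r / 2" if "\<alpha> < r" for r
  proof -
    have "ennreal h * distr_fun \<mu> f (r + h) \<le> ennreal M * distr_fun \<mu> f r"
      using distr_fun_le_tail tail[OF that] by (rule order_trans)
    then have "h * D (r + h) \<le> M * D r"
      using that h \<open>0 \<le> M\<close> D by (simp add: ennreal_mult[symmetric])
    also have "\<dots> \<le> h * (D r / 2)"
      using D(2)[OF that] by (simp add: h_def algebra_simps)
    finally show ?thesis using h by simp
  qed
  have iterate: "D (r\<^sub>1 + n * h) \<le> D r\<^sub>1 / 2 ^ n" for n :: nat
  proof (induction n)
    case (Suc n)
    have "\<alpha> < r\<^sub>1 + n * h" using r h by (smt (verit) mult_nonneg_nonneg of_nat_0_le_iff)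
    from half[OF this] Suc show ?case by (simp add: algebra_simps)
  qed simp
  \<comment> \<open>The number of full steps that fit between \<open>r\<^sub>1\<close> and
    \<open>r\<^sub>2\<close>. The remaining fraction of a step costs at most a factor 2, the
    constant in the conclusion.\<close>
  define n where "n = nat \<lfloor>(r\<^sub>2 - r\<^sub>1) / h\<rfloor>"
  have n: "real n \<le> (r\<^sub>2 - r\<^sub>1) / h" "(r\<^sub>2 - r\<^sub>1) / h \<le> real n + 1"
    using r h by (simp_all add: n_def)
  have gt: "\<alpha> < r\<^sub>1 + n * h" using r h by (smt (verit) mult_nonneg_nonneg of_nat_0_le_iff)
  have "r\<^sub>1 + n * h \<le> r\<^sub>2" using n(1) h by (simp add: field_simps)
  then have "distr_fun \<mu> f r\<^sub>2 \<le> ennreal (D (r\<^sub>1 + n * h))"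
    unfolding D(1)[OF gt, symmetric] by (rule distr_fun_mono)
  also have "\<dots> \<le> ennreal (2 * D r\<^sub>1 * exp (ln 2 / h * (r\<^sub>1 - r\<^sub>2)))"
  proof (rule ennreal_leI)
    have "ln 2 * ((r\<^sub>2 - r\<^sub>1) / h) \<le> ln 2 * (real n + 1)"
      using n(2) by (intro mult_left_mono) auto
    then have "- (n * ln 2) \<le> ln 2 + ln 2 / h * (r\<^sub>1 - r\<^sub>2)"
      by (simp add: algebra_simps diff_divide_distrib)
    then have "exp (- (n * ln 2)) \<le> 2 * exp (ln 2 / h * (r\<^sub>1 - r\<^sub>2))"
      by (subst (asm) exp_le_cancel_iff[symmetric]) (simp add: exp_add)
    moreover have "exp (- (n * ln 2)) = 1 / (2::real) ^ n"
      by (simp add: exp_minus exp_of_nat_mult divide_inverse)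
    ultimately have "D r\<^sub>1 * (1 / 2 ^ n) \<le> D r\<^sub>1 * (2 * exp (ln 2 / h * (r\<^sub>1 - r\<^sub>2)))"
      using D(2)[OF r(1)] by (intro mult_left_mono) auto
    with iterate[of n] show "D (r\<^sub>1 + n * h) \<le> 2 * D r\<^sub>1 * exp (ln 2 / h * (r\<^sub>1 - r\<^sub>2))"
      by (simp add: mult_ac)
  qed
  also have "\<dots> = ennreal 2 * distr_fun \<mu> f r\<^sub>1 * ennreal (exp (ln 2 / h * (r\<^sub>1 - r\<^sub>2)))"
    using D[OF r(1)] by (simp add: ennreal_mult')
  finally show ?thesis unfolding h_def .
qed

text \<open>Extends the decay to starting points in [0, \<alpha>]. Moving the start beyond \<alpha>
  changes the exponent by at most \<open>c\<^sub>2 * (\<alpha> + 1)\<close>, which the new constant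
  absorbs. If \<open>r\<^sub>2\<close> is at most \<alpha> + 1, monotonicity of d suffices: the
  factor is then at least 1, thanks to \<open>c\<^sub>1 + 1\<close> in place of
  \<open>c\<^sub>1\<close>.\<close>

lemma distr_fun_exp_decay_all:
  assumes "0 \<le> \<alpha>" "0 < c\<^sub>1" "0 < c\<^sub>2"
    and decay: "\<And>r\<^sub>1 r\<^sub>2. \<alpha> < r\<^sub>1 \<Longrightarrow> r\<^sub>1 \<le> r\<^sub>2 \<Longrightarrow>
      distr_fun \<mu> f r\<^sub>2 \<le> ennreal c\<^sub>1 * distr_fun \<mu> f r\<^sub>1 * ennreal (exp (c\<^sub>2 * (r\<^sub>1 - r\<^sub>2)))"
    and r: "0 \<le> r\<^sub>1" "r\<^sub>1 \<le> r\<^sub>2"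
  shows "distr_fun \<mu> f r\<^sub>2
    \<le> ennreal ((c\<^sub>1 + 1) * exp (c\<^sub>2 * (\<alpha> + 1))) * distr_fun \<mu> f r\<^sub>1 * ennreal (exp (c\<^sub>2 * (r\<^sub>1 - r\<^sub>2)))"
proof -
  \<comment> \<open>Reduces the claim to a comparison of real factors; d may be infinite at
    \<open>r\<^sub>1\<close>.\<close>
  have *: ?thesis
    if "distr_fun \<mu> f r\<^sub>2 \<le> ennreal K * distr_fun \<mu> f r\<^sub>1" "0 \<le> K"
      "K \<le> (c\<^sub>1 + 1) * exp (c\<^sub>2 * (\<alpha> + 1)) * exp (c\<^sub>2 * (r\<^sub>1 - r\<^sub>2))" for K
  proof -
    note that(1)
    also have "ennreal K * distr_fun \<mu> f r\<^sub>1 \<le>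
      ennreal ((c\<^sub>1 + 1) * exp (c\<^sub>2 * (\<alpha> + 1)) * exp (c\<^sub>2 * (r\<^sub>1 - r\<^sub>2))) * distr_fun \<mu> f r\<^sub>1"
      using that by (intro mult_right_mono ennreal_leI) auto
    also have "\<dots> = ennreal ((c\<^sub>1 + 1) * exp (c\<^sub>2 * (\<alpha> + 1))) * distr_fun \<mu> f r\<^sub>1
        * ennreal (exp (c\<^sub>2 * (r\<^sub>1 - r\<^sub>2)))"
      using \<open>0 < c\<^sub>1\<close> by (subst ennreal_mult) (auto simp: mult_ac)
    finally show ?thesis .
  qed
  show ?thesis
  proof (cases "r\<^sub>2 \<le> \<alpha> + 1")
    case True
    have "1 * 1 \<le> (c\<^sub>1 + 1) * exp (c\<^sub>2 * (\<alpha> + 1) + c\<^sub>2 * (r\<^sub>1 - r\<^sub>2))"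
    proof (intro mult_mono)
      have "0 \<le> c\<^sub>2 * ((\<alpha> + 1 - r\<^sub>2) + r\<^sub>1)" using True r assms by simp
      then show "1 \<le> exp (c\<^sub>2 * (\<alpha> + 1) + c\<^sub>2 * (r\<^sub>1 - r\<^sub>2))" by (simp add: algebra_simps)
    qed (use assms in auto)
    then show ?thesis
      using distr_fun_mono[OF r(2)] by (intro *[of 1]) (auto simp: exp_add mult.assoc)
  next
    case False
    \<comment> \<open>A starting point where \<open>decay\<close> applies: from
      \<open>m \<ge> r\<^sub>1\<close> follows d(m) <= d(\<open>r\<^sub>1\<close>), and
      \<open>m \<le> r\<^sub>1 + \<alpha> + 1\<close> limits the loss in the exponent.\<close>
    define m where "m = max r\<^sub>1 (\<alpha> + 1)"
    have "distr_fun \<mu> f r\<^sub>2 \<le> ennreal c\<^sub>1 * distr_fun \<mu> f m * ennreal (exp (c\<^sub>2 * (m - r\<^sub>2)))"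
      using False r by (intro decay) (auto simp: m_def)
    also have "\<dots> \<le> ennreal c\<^sub>1 * distr_fun \<mu> f r\<^sub>1 * ennreal (exp (c\<^sub>2 * (m - r\<^sub>2)))"
      by (intro mult_right_mono mult_left_mono distr_fun_mono) (auto simp: m_def)
    also have "\<dots> = ennreal (c\<^sub>1 * exp (c\<^sub>2 * (m - r\<^sub>2))) * distr_fun \<mu> f r\<^sub>1"
      using \<open>0 < c\<^sub>1\<close> by (subst ennreal_mult) (auto simp: mult_ac)
    finally have "distr_fun \<mu> f r\<^sub>2 \<le> ennreal (c\<^sub>1 * exp (c\<^sub>2 * (m - r\<^sub>2))) * distr_fun \<mu> f r\<^sub>1" .
    moreover have "c\<^sub>1 * exp (c\<^sub>2 * (m - r\<^sub>2)) \<le> (c\<^sub>1 + 1) * exp (c\<^sub>2 * (\<alpha> + 1) + c\<^sub>2 * (r\<^sub>1 - r\<^sub>2))"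
    proof (intro mult_mono)
      have "c\<^sub>2 * (m - r\<^sub>2) \<le> c\<^sub>2 * ((\<alpha> + 1) + (r\<^sub>1 - r\<^sub>2))"
        using r assms by (intro mult_left_mono) (auto simp: m_def)
      then show "exp (c\<^sub>2 * (m - r\<^sub>2)) \<le> exp (c\<^sub>2 * (\<alpha> + 1) + c\<^sub>2 * (r\<^sub>1 - r\<^sub>2))"
        by (simp add: algebra_simps)
    qed (use assms in auto)
    ultimately show ?thesis
      using assms by (intro *) (auto simp: exp_add mult.assoc)
  qed
qed

text \<open>The constant is \<open>c\<^sub>1\<close> times the integral of
  \<open>exp (c\<^sub>2 * (r - s))\<close> over s >= r, which equals
  \<open>1 / c\<^sub>2\<close>.\<close>

lemma tail_le_of_exp_decay:
  assumes "0 < c\<^sub>1" "0 < c\<^sub>2"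
    and decay: "\<And>s. r < s \<Longrightarrow>
      distr_fun \<mu> f s \<le> ennreal c\<^sub>1 * distr_fun \<mu> f r * ennreal (exp (c\<^sub>2 * (r - s)))"
  shows "(\<integral>\<^sup>+ s\<in>{r<..}. distr_fun \<mu> f s \<partial>lborel) \<le> ennreal (c\<^sub>1 / c\<^sub>2) * distr_fun \<mu> f r"
proof -
  have "(\<integral>\<^sup>+ s\<in>{r<..}. distr_fun \<mu> f s \<partial>lborel)
    \<le> (\<integral>\<^sup>+ s. ennreal c\<^sub>1 * distr_fun \<mu> f r * (ennreal (exp (c\<^sub>2 * (r - s))) * indicator {r..} s) \<partial>lborel)"
    by (intro nn_integral_mono) (auto simp: indicator_def decay)
  also have "\<dots> = ennreal c\<^sub>1 * distr_fun \<mu> f r *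
      (\<integral>\<^sup>+ s. ennreal (exp (c\<^sub>2 * (r - s))) * indicator {r..} s \<partial>lborel)"
    by (intro nn_integral_cmult) measurable
  also have "(\<integral>\<^sup>+ s. ennreal (exp (c\<^sub>2 * (r - s))) * indicator {r..} s \<partial>lborel)
    = ennreal (0 - (- exp (c\<^sub>2 * (r - r)) / c\<^sub>2))"
  proof (rule nn_integral_FTC_atLeast[where F = "\<lambda>s. - exp (c\<^sub>2 * (r - s)) / c\<^sub>2"])
    show "DERIV (\<lambda>s. - exp (c\<^sub>2 * (r - s)) / c\<^sub>2) s :> exp (c\<^sub>2 * (r - s))" for s
      using \<open>0 < c\<^sub>2\<close> by (auto intro!: derivative_eq_intros)
    \<comment> \<open>The exponent is written as the negative of a function tending to infinity, so
      that \<open>exp_at_bot\<close> applies.\<close>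
    have "filterlim (\<lambda>s. - (c\<^sub>2 * r) + c\<^sub>2 * s) at_top at_top"
      using \<open>0 < c\<^sub>2\<close>
      by (intro filterlim_tendsto_add_at_top[OF tendsto_const]
          filterlim_tendsto_pos_mult_at_top[OF tendsto_const _ filterlim_ident])
    then have "((\<lambda>s. exp (- (- (c\<^sub>2 * r) + c\<^sub>2 * s))) \<longlongrightarrow> 0) at_top"
      by (intro filterlim_compose[OF exp_at_bot] filterlim_compose[OF filterlim_uminus_at_bot_at_top])
    then have "((\<lambda>s. - exp (- (- (c\<^sub>2 * r) + c\<^sub>2 * s)) / c\<^sub>2) \<longlongrightarrow> - 0 / c\<^sub>2) at_top"
      by (intro tendsto_intros) (use \<open>0 < c\<^sub>2\<close> in auto)
    then show "((\<lambda>s. - exp (c\<^sub>2 * (r - s)) / c\<^sub>2) \<longlongrightarrow> 0) at_top"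
      by (simp add: algebra_simps)
  qed auto
  also have "ennreal c\<^sub>1 * distr_fun \<mu> f r * ennreal (0 - (- exp (c\<^sub>2 * (r - r)) / c\<^sub>2))
    = ennreal (c\<^sub>1 / c\<^sub>2) * distr_fun \<mu> f r"
  proof -
    have "ennreal (c\<^sub>1 / c\<^sub>2) = ennreal c\<^sub>1 * ennreal (1 / c\<^sub>2)"
      using assms by (simp add: ennreal_mult[symmetric])
    then show ?thesis by (simp add: mult_ac)
  qed
  finally show ?thesis .
qed

section \<open>Tail bound and the difference f** - f*\<close>

text \<open>Since h d(r + h) <= M d(r), the function d drops to any level \<open>t > 0\<close> far
  enough to the right, and f*(t) is at most such a point.\<close>

lemma decr_rearr_finite:
  assumes fin: "distr_fun \<mu> f r < \<infinity>" "0 \<le> r" "0 \<le> M"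
    and tail: "(\<integral>\<^sup>+ s\<in>{r<..}. distr_fun \<mu> f s \<partial>lborel) \<le> ennreal M * distr_fun \<mu> f r"
    and "0 < t"
  shows "decr_rearr \<mu> f t < \<infinity>"
proof -
  obtain D where D: "0 \<le> D" "distr_fun \<mu> f r = ennreal D"
    using fin(1) by (cases "distr_fun \<mu> f r") auto
  \<comment> \<open>Chosen so that \<open>M * D \<le> h * t\<close>; the summand 1 keeps
    \<open>h\<close> positive when \<open>M * D = 0\<close>.\<close>
  define h where "h = M * D / t + 1"
  have h: "0 < h" "M * D \<le> h * t"
    using D assms by (auto simp: h_def distrib_right intro: add_nonneg_pos)
  have "ennreal h * distr_fun \<mu> f (r + h) \<le> ennreal (M * D)"
    using order_trans[OF distr_fun_le_tail tail] D \<open>0 \<le> M\<close> by (simp add: ennreal_mult)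
  also have "\<dots> \<le> ennreal h * ennreal t"
    using h \<open>0 < t\<close> by (simp add: ennreal_mult[symmetric] ennreal_leI)
  finally have "distr_fun \<mu> f (r + h) \<le> ennreal t"
    using h by (simp add: ennreal_mult_le_mult_iff)
  then have "decr_rearr \<mu> f t \<le> ennreal (r + h)"
    using decr_rearr_le_iff[OF f, of "r + h"] h \<open>0 \<le> r\<close> by simp
  then show ?thesis by (simp add: le_less_trans)
qed

text \<open>The tail bound holds only beyond \<alpha>, while f*(t) may be smaller. The tail is
  therefore split at \<open>m\<close>: up to \<open>m\<close>, d is at most \<open>t\<close> on an
  interval of length at most \<alpha> + 1; beyond \<open>m\<close>, the tail is at most M d(m) <= M
  t.\<close>

lemma decr_rearr_avg_diff_le:
  assumes "0 \<le> \<alpha>" "0 \<le> M"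
    and tail: "\<And>r. \<alpha> < r \<Longrightarrow>
      (\<integral>\<^sup>+ s\<in>{r<..}. distr_fun \<mu> f s \<partial>lborel) \<le> ennreal M * distr_fun \<mu> f r"
    and "0 < t" and fin: "decr_rearr \<mu> f t < \<infinity>"
  shows "decr_rearr_avg \<mu> f t - decr_rearr \<mu> f t \<le> ennreal (\<alpha> + 1 + M)"
proof -
  obtain l where l: "0 \<le> l" "decr_rearr \<mu> f t = ennreal l"
    using fin by (cases "decr_rearr \<mu> f t") auto
  define m where "m = max l (\<alpha> + 1)"
  have le: "distr_fun \<mu> f s \<le> ennreal t" if "l \<le> s" for s
    using decr_rearr_le_iff[OF f, of s t] that l by (simp add: ennreal_leI)
  have "(\<integral>\<^sup>+ s\<in>{l<..}. distr_fun \<mu> f s \<partial>lborel)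
    \<le> (\<integral>\<^sup>+ s. ennreal t * indicator {l<..m} s + distr_fun \<mu> f s * indicator {m<..} s \<partial>lborel)"
    by (intro nn_integral_mono) (auto simp: indicator_def le m_def)
  also have "\<dots> = ennreal t * ennreal (m - l) + (\<integral>\<^sup>+ s\<in>{m<..}. distr_fun \<mu> f s \<partial>lborel)"
    by (simp add: nn_integral_add nn_integral_cmult m_def)
  also have "\<dots> \<le> ennreal t * ennreal (\<alpha> + 1) + ennreal M * ennreal t"
  proof (intro add_mono mult_left_mono ennreal_leI)
    have "(\<integral>\<^sup>+ s\<in>{m<..}. distr_fun \<mu> f s \<partial>lborel) \<le> ennreal M * distr_fun \<mu> f m"
      by (intro tail) (simp add: m_def)
    also have "\<dots> \<le> ennreal M * ennreal t"
      by (intro mult_left_mono le) (auto simp: m_def)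
    finally show "(\<integral>\<^sup>+ s\<in>{m<..}. distr_fun \<mu> f s \<partial>lborel) \<le> ennreal M * ennreal t" .
  qed (use l \<open>0 \<le> \<alpha>\<close> in \<open>auto simp: m_def\<close>)
  also have "\<dots> = ennreal (t * (\<alpha> + 1 + M))"
    using assms by (simp add: ennreal_mult[symmetric] ennreal_plus[symmetric] algebra_simps
        del: ennreal_plus)
  finally have "(\<integral>\<^sup>+ s\<in>{l<..}. distr_fun \<mu> f s \<partial>lborel) \<le> ennreal (t * (\<alpha> + 1 + M))" .
  then have "decr_rearr_avg \<mu> f t - decr_rearr \<mu> f t
    \<le> ennreal (1 / t) * ennreal (t * (\<alpha> + 1 + M))"
    unfolding decr_rearr_avg_diff[OF \<open>0 < t\<close> l] by (rule mult_left_mono) simp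
  also have "\<dots> = ennreal (\<alpha> + 1 + M)"
    using \<open>0 < t\<close> \<open>0 \<le> \<alpha>\<close> \<open>0 \<le> M\<close> by (simp add: ennreal_mult[symmetric])
  finally show ?thesis .
qed

text \<open>The hypothesis is used at t = d(r). There f*(t) <= r, so the tail beyond
  \<open>r\<close> is part of the tail beyond f*(t), which is t (f**(t) - f*(t)) <= M d(r). For d(r)
  = 0 no such \<open>t\<close> is available, but the tail vanishes.\<close>

lemma tail_le_of_decr_rearr_avg:
  assumes "0 \<le> r" "0 \<le> M" and fin: "distr_fun \<mu> f r < \<infinity>"
    and avg: "\<And>t. 0 < t \<Longrightarrow> decr_rearr_avg \<mu> f t - decr_rearr \<mu> f t \<le> ennreal M"
  shows "(\<integral>\<^sup>+ s\<in>{r<..}. distr_fun \<mu> f s \<partial>lborel) \<le> ennreal M * distr_fun \<mu> f r"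
proof -
  obtain t where t: "0 \<le> t" "distr_fun \<mu> f r = ennreal t"
    using fin by (cases "distr_fun \<mu> f r") auto
  show ?thesis
  proof (cases "t = 0")
    case True
    have "distr_fun \<mu> f s = 0" if "r < s" for s
      using distr_fun_mono[of r s] that t True by simp
    then have "(\<integral>\<^sup>+ s\<in>{r<..}. distr_fun \<mu> f s \<partial>lborel) = (\<integral>\<^sup>+ s. 0 \<partial>(lborel::real measure))"
      by (intro nn_integral_cong) (auto simp: indicator_def)
    then show ?thesis by simp
  next
    case False
    with t have "0 < t" by simp
    have le: "decr_rearr \<mu> f t \<le> ennreal r"
      using decr_rearr_le_iff[OF f \<open>0 \<le> r\<close>, of t] t by simp
    then obtain l where l: "0 \<le> l" "decr_rearr \<mu> f t = ennreal l"
      by (cases "decr_rearr \<mu> f t") (auto simp: top_unique)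
    have "l \<le> r" using le l \<open>0 \<le> r\<close> by simp
    then have "(\<integral>\<^sup>+ s\<in>{r<..}. distr_fun \<mu> f s \<partial>lborel)
      \<le> (\<integral>\<^sup>+ s\<in>{l<..}. distr_fun \<mu> f s \<partial>lborel)" (is "_ \<le> ?J")
      by (intro nn_integral_mono) (auto simp: indicator_def)
    also have "\<dots> = ennreal t * (ennreal (1 / t) * ?J)"
      using \<open>0 < t\<close> by (simp add: mult.assoc[symmetric] ennreal_mult[symmetric])
    also have "\<dots> \<le> ennreal t * ennreal M"
      using avg[OF \<open>0 < t\<close>] unfolding decr_rearr_avg_diff[OF \<open>0 < t\<close> l] by (rule mult_left_mono) simp
    finally show ?thesis using t by (simp add: mult.commute)
  qed
qed

end

section \<open>Equivalence of the four conditions by way of the tail bound (iii)\<close>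

theorem theorem2p1:
  fixes \<mu> :: "'a measure" and f :: "'a \<Rightarrow> real"
  assumes "L1_loc \<mu> f"
    and "\<exists>r\<ge>0. distr_fun \<mu> f r < \<infinity>"
  defines "cond_i \<equiv>
      (\<forall>t>0. decr_rearr \<mu> f t < \<infinity>) \<and>
      (\<exists>M\<ge>0. \<forall>t>0. decr_rearr_avg \<mu> f t - decr_rearr \<mu> f t \<le> ennreal M)"
    and "cond_ii \<equiv>
      (\<exists>\<alpha>\<ge>0. \<exists>M\<ge>0. \<forall>r>\<alpha>. distr_fun \<mu> f r < \<infinity> \<and>
        (\<integral>\<^sup>+ x\<in>{x \<in> space \<mu>. \<bar>f x\<bar> > r}. ennreal \<bar>f x\<bar> \<partial>\<mu>)
          \<le> ennreal (r + M) * distr_fun \<mu> f r)"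
    and "cond_iii \<equiv>
      (\<exists>\<alpha>\<ge>0. \<exists>M\<ge>0. \<forall>r>\<alpha>. distr_fun \<mu> f r < \<infinity> \<and>
        (\<integral>\<^sup>+ s\<in>{r<..}. distr_fun \<mu> f s \<partial>lborel) \<le> ennreal M * distr_fun \<mu> f r)"
    and "cond_iv \<equiv>
      (\<exists>c\<^sub>1>0. \<exists>c\<^sub>2>0. \<forall>r\<^sub>1 r\<^sub>2. 0 \<le> r\<^sub>1 \<and> r\<^sub>1 < r\<^sub>2 \<longrightarrow>
        distr_fun \<mu> f r\<^sub>2
          \<le> ennreal c\<^sub>1 * distr_fun \<mu> f r\<^sub>1 * ennreal (exp (c\<^sub>2 * (r\<^sub>1 - r\<^sub>2))))"
  shows "(cond_i \<longleftrightarrow> cond_ii) \<and> (cond_ii \<longleftrightarrow> cond_iii) \<and> (cond_iii \<longleftrightarrow> cond_iv)"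
proof -
  have f: "f \<in> borel_measurable \<mu>"
    using assms(1) by (simp add: L1_loc_def)
  obtain r\<^sub>0 where r\<^sub>0: "0 \<le> r\<^sub>0" "distr_fun \<mu> f r\<^sub>0 < \<infinity>"
    using assms(2) by blast
  \<comment> \<open>One finite value of d gives finiteness at all larger levels;
    \<open>r\<^sub>0\<close> then serves as \<alpha> when (iii) is derived from (i) or (iv).\<close>
  have fin: "distr_fun \<mu> f r < \<infinity>" if "r\<^sub>0 < r" for r
    using distr_fun_mono[OF f, of r\<^sub>0 r] that r\<^sub>0 by (auto intro: le_less_trans)

  have ii_iii: "cond_ii \<longleftrightarrow> cond_iii"
    unfolding cond_ii_def cond_iii_def
    by (intro ex_cong1 conj_cong refl all_cong) (use nn_integral_superlevel_le_iff[OF f] in auto)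

  have iii_iv: cond_iv if cond_iii
  proof -
    from that obtain \<alpha> M where *: "0 \<le> \<alpha>" "0 \<le> M"
      "\<And>r. \<alpha> < r \<Longrightarrow> distr_fun \<mu> f r < \<infinity>"
      "\<And>r. \<alpha> < r \<Longrightarrow>
        (\<integral>\<^sup>+ s\<in>{r<..}. distr_fun \<mu> f s \<partial>lborel) \<le> ennreal M * distr_fun \<mu> f r"
      unfolding cond_iii_def by blast
    define c where "c = ln 2 / (2 * M + 1)"
    have c: "0 < c" using \<open>0 \<le> M\<close> by (simp add: c_def)
    \<comment> \<open>The constant of \<open>distr_fun_exp_decay_all\<close> for
      \<open>c\<^sub>1 = 2\<close>, the factor from \<open>distr_fun_exp_decay\<close>.\<close>
    have "0 < (2 + 1) * exp (c * (\<alpha> + 1))" by simp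
    moreover note c
    moreover have "distr_fun \<mu> f r\<^sub>2 \<le> ennreal ((2 + 1) * exp (c * (\<alpha> + 1))) * distr_fun \<mu> f r\<^sub>1
        * ennreal (exp (c * (r\<^sub>1 - r\<^sub>2)))" if "0 \<le> r\<^sub>1 \<and> r\<^sub>1 < r\<^sub>2" for r\<^sub>1 r\<^sub>2
      using distr_fun_exp_decay[OF f *, folded c_def] c that \<open>0 \<le> \<alpha>\<close>
      by (intro distr_fun_exp_decay_all[OF f]) auto
    ultimately show ?thesis unfolding cond_iv_def by blast
  qed

  have iv_iii: cond_iii if cond_iv
  proof -
    from that obtain c\<^sub>1 c\<^sub>2 where c: "0 < c\<^sub>1" "0 < c\<^sub>2" and
      decay: "\<And>r s. 0 \<le> r \<Longrightarrow> r < s \<Longrightarrow>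
        distr_fun \<mu> f s \<le> ennreal c\<^sub>1 * distr_fun \<mu> f r * ennreal (exp (c\<^sub>2 * (r - s)))"
      unfolding cond_iv_def by blast
    have "(\<integral>\<^sup>+ s\<in>{r<..}. distr_fun \<mu> f s \<partial>lborel) \<le> ennreal (c\<^sub>1 / c\<^sub>2) * distr_fun \<mu> f r"
      if "r\<^sub>0 < r" for r
      using r\<^sub>0 that by (intro tail_le_of_exp_decay[OF f c] decay) auto
    moreover have "0 \<le> c\<^sub>1 / c\<^sub>2" using c by simp
    ultimately show ?thesis unfolding cond_iii_def using r\<^sub>0(1) fin by blast
  qed

  have i_iii: cond_iii if cond_i
  proof -
    from that obtain M where M: "0 \<le> M"
      "\<And>t. 0 < t \<Longrightarrow> decr_rearr_avg \<mu> f t - decr_rearr \<mu> f t \<le> ennreal M"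
      unfolding cond_i_def by blast
    have "(\<integral>\<^sup>+ s\<in>{r<..}. distr_fun \<mu> f s \<partial>lborel) \<le> ennreal M * distr_fun \<mu> f r"
      if "r\<^sub>0 < r" for r
      using r\<^sub>0 that M fin by (intro tail_le_of_decr_rearr_avg[OF f]) auto
    then show ?thesis unfolding cond_iii_def using r\<^sub>0(1) fin M(1) by blast
  qed

  have iii_i: cond_i if cond_iii
  proof -
    from that obtain \<alpha> M where *: "0 \<le> \<alpha>" "0 \<le> M"
      "\<And>r. \<alpha> < r \<Longrightarrow> distr_fun \<mu> f r < \<infinity>"
      "\<And>r. \<alpha> < r \<Longrightarrow>
        (\<integral>\<^sup>+ s\<in>{r<..}. distr_fun \<mu> f s \<partial>lborel) \<le> ennreal M * distr_fun \<mu> f r"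
      unfolding cond_iii_def by blast
    \<comment> \<open>The level \<alpha> + 1 is a point beyond \<alpha>, where d is finite and the
      tail bound holds.\<close>
    have rearr: "decr_rearr \<mu> f t < \<infinity>" if "0 < t" for t
      using * that by (intro decr_rearr_finite[OF f, of "\<alpha> + 1" M]) auto
    then have "decr_rearr_avg \<mu> f t - decr_rearr \<mu> f t \<le> ennreal (\<alpha> + 1 + M)" if "0 < t" for t
      using * that by (intro decr_rearr_avg_diff_le[OF f]) auto
    moreover have "0 \<le> \<alpha> + 1 + M" using * by simp
    ultimately show ?thesis unfolding cond_i_def using rearr by blast
  qed

  show ?thesis using ii_iii iii_iv iv_iii i_iii iii_i by blast
qed

end
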